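(* Let $1\le b\le m$ be integers and let $(x_0,x_1,\dots,x_b)$ be an arbitrary probability distribution on $\{0,1,\dots,b\}$. The Reverse Juggling Markov Chain (RJMC) on $\mathbb{B}^{m,b}$ converges to its stationary distribution in at most $m$ steps; that is, if $M$ is its transition matrix and $\pi$ its stationary distribution, then $\mu M^m=\pi$ for every initial probability distribution $\mu$ on $\mathbb{B}^{m,b}$.
   Context: $\mathbb{B}^{m,b}$ is the set of binary words $w=(w_1,\dots,w_m)$ of length $m$ with at most $b$ ones. The Reverse Juggling Markov Chain (RJMC) on $\mathbb{B}^{m,b}$ has the following transitions from $w$, where $\ell$ denotes the number of ones among the first $m-1$ letters $w_1,\dots,w_{m-1}$: (1) with probability $x_0$, go to $(0,w_1,\dots,w_{m-1})$; (2) for each $1\le i\le \ell$, with probability $x_i$, go to $(1,w'_1,\dots,w'_{m-1})$, where $(w'_1,\dots,w'_{m-1})$ is obtained from $(w_1,\dots,w_{m-1})$ by replacing its $i$'th one from the left by a zero; (3) with probability $x_{\ell+1}+\cdots+x_b$, go to $(1,w_1,\dots,w_{m-1})$ (this probability is $0$ if $\ell=b$). A stationary distribution is a probability (row) vector $\pi$ with $\pi M=\pi$. *)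

theory Defs
  imports Complex_Main "Jordan_Normal_Form.Matrix"
begin

text \<open>A binary word is a list of booleans; \<^term>\<open>True\<close> is the letter 1 and
  \<^term>\<open>False\<close> the letter 0.\<close>

definition num_ones :: "bool list \<Rightarrow> nat" where
  "num_ones w = count_list w True"

definition binary_words :: "nat \<Rightarrow> nat \<Rightarrow> bool list set" where
  "binary_words m b = {w. length w = m \<and> num_ones w \<le> b}"

definition one_positions :: "bool list \<Rightarrow> nat list" where
  "one_positions w = filter (\<lambda>p. w ! p) [0..<length w]"

text \<open>The \<open>i\<close>'th one from the left is counted from \<open>i = 1\<close>; the value is only meaningful
  for \<open>1 \<le> i \<le> num_ones w\<close>.\<close>

definition erase_one :: "nat \<Rightarrow> bool list \<Rightarrow> bool list" where
  "erase_one i w = w[one_positions w ! (i - 1) := False]"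

text \<open>Probability of going from \<open>w\<close> to \<open>v\<close>: each transition contributes its probability
  if its target is \<open>v\<close>. If \<open>l = b\<close> the last sum is empty.\<close>

definition rjmc_prob :: "nat \<Rightarrow> (nat \<Rightarrow> real) \<Rightarrow> bool list \<Rightarrow> bool list \<Rightarrow> real" where
  "rjmc_prob b x w v =
    (let u = butlast w; l = num_ones u in
      (if v = False # u then x 0 else 0)
      + (\<Sum>i=1..l. if v = True # erase_one i u then x i else 0)
      + (if v = True # u then (\<Sum>i=l+1..b. x i) else 0))"

text \<open>The library's matrices are indexed by natural numbers, so the transition matrix is
  written with respect to an enumeration \<open>ws\<close> of the states.\<close>

definition rjmc_matrix :: "nat \<Rightarrow> (nat \<Rightarrow> real) \<Rightarrow> bool list list \<Rightarrow> real mat" where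
  "rjmc_matrix b x ws =
    mat (length ws) (length ws) (\<lambda>(i, j). rjmc_prob b x (ws ! i) (ws ! j))"

text \<open>Row vectors of length \<open>n\<close> are \<open>1 \<times> n\<close> matrices.\<close>

definition prob_row :: "nat \<Rightarrow> real mat \<Rightarrow> bool" where
  "prob_row n \<mu> \<longleftrightarrow>
    \<mu> \<in> carrier_mat 1 n \<and> (\<forall>j<n. 0 \<le> \<mu> $$ (0, j)) \<and> (\<Sum>j<n. \<mu> $$ (0, j)) = 1"

definition stationary :: "real mat \<Rightarrow> real mat \<Rightarrow> bool" where
  "stationary M \<pi> \<longleftrightarrow> prob_row (dim_row M) \<pi> \<and> \<pi> * M = \<pi>"

end

theory Submission
  imports Defs
begin

text \<open>Drive the chain by a random index \<open>i\<close> with law \<open>x\<close>: for \<open>i = 0\<close> push a zero in front,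
  otherwise push a one and erase the \<open>i\<close>'th remaining one if there is one. The first \<open>k + 1\<close>
  letters of the new word depend only on \<open>i\<close> and on the first \<open>k\<close> letters of the old one, so
  a function of the first \<open>k + 1\<close> letters is mapped by the transition operator to a function
  of the first \<open>k\<close> letters. Hence all rows of the \<open>m\<close>'th power of the transition matrix are
  equal.\<close>

section \<open>Row-stochastic matrices with a constant power\<close>

text \<open>\<open>pow_mat\<close> appends the new factor on the right; conditioning on the first
  step of the chain needs it on the left.\<close>

lemma pow_mat_Suc_left:
  assumes "A \<in> carrier_mat n n"
  shows "A ^\<^sub>m Suc k = A * A ^\<^sub>m k"
proof (induction k)
  case 0
  then show ?case using assms by simp
next
  case (Suc k)
  have "A ^\<^sub>m Suc (Suc k) = (A * A ^\<^sub>m k) * A" using Suc by simp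
  also have "\<dots> = A * (A ^\<^sub>m k * A)"
    using assms by (intro assoc_mult_mat[of _ n n _ n _ n]) auto
  finally show ?case by simp
qed

lemma index_mult_mat_sum:
  assumes "A \<in> carrier_mat r n" "B \<in> carrier_mat n c" "i < r" "j < c"
  shows "(A * B) $$ (i, j) = (\<Sum>k<n. A $$ (i, k) * B $$ (k, j))"
  using assms by (auto simp: scalar_prod_def lessThan_atLeast0 intro!: sum.cong)

definition stochastic_mat :: "nat \<Rightarrow> real mat \<Rightarrow> bool" where
  "stochastic_mat n M \<longleftrightarrow> M \<in> carrier_mat n n \<and>
    (\<forall>i<n. (\<forall>j<n. 0 \<le> M $$ (i, j)) \<and> (\<Sum>j<n. M $$ (i, j)) = 1)"

lemma prob_row_mult:
  assumes M: "stochastic_mat n M" and mu: "prob_row n \<mu>"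
  shows "prob_row n (\<mu> * M)"
proof -
  have c: "\<mu> \<in> carrier_mat 1 n" "M \<in> carrier_mat n n"
    using assms by (auto simp: prob_row_def stochastic_mat_def)
  have e: "(\<mu> * M) $$ (0, j) = (\<Sum>k<n. \<mu> $$ (0, k) * M $$ (k, j))" if "j < n" for j
    using index_mult_mat_sum[OF c] that by simp
  have "(\<Sum>j<n. (\<mu> * M) $$ (0, j)) = (\<Sum>j<n. \<Sum>k<n. \<mu> $$ (0, k) * M $$ (k, j))"
    using e by simp
  also have "\<dots> = (\<Sum>k<n. \<mu> $$ (0, k) * (\<Sum>j<n. M $$ (k, j)))"
    by (subst sum.swap) (simp add: sum_distrib_left)
  also have "\<dots> = 1"
    using assms by (simp add: prob_row_def stochastic_mat_def)
  finally have "(\<Sum>j<n. (\<mu> * M) $$ (0, j)) = 1" .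
  moreover have "0 \<le> (\<mu> * M) $$ (0, j)" if "j < n" for j
    using assms that by (auto simp: e prob_row_def stochastic_mat_def intro!: sum_nonneg)
  ultimately show ?thesis
    using c by (simp add: prob_row_def)
qed

lemma prob_row_mult_pow:
  assumes "stochastic_mat n M" "prob_row n \<mu>"
  shows "prob_row n (\<mu> * M ^\<^sub>m k)"
proof (induction k)
  case 0
  then show ?case using assms by (auto simp: prob_row_def stochastic_mat_def)
next
  case (Suc k)
  have "\<mu> * M ^\<^sub>m Suc k = \<mu> * M ^\<^sub>m k * M"
    using assms by (auto simp: prob_row_def stochastic_mat_def
        intro!: assoc_mult_mat[symmetric, of _ 1 n _ n _ n])
  then show ?case using prob_row_mult[OF assms(1) Suc] by simp
qed

lemma stationary_mult_pow:
  assumes "M \<in> carrier_mat n n" "stationary M \<pi>"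
  shows "\<pi> * M ^\<^sub>m k = \<pi>"
proof (induction k)
  case 0
  then show ?case using assms by (auto simp: stationary_def prob_row_def)
next
  case (Suc k)
  have "\<pi> * M ^\<^sub>m Suc k = \<pi> * M ^\<^sub>m k * M"
    using assms by (auto simp: stationary_def prob_row_def
        intro!: assoc_mult_mat[symmetric, of _ 1 n _ n _ n])
  then show ?case using Suc assms by (simp add: stationary_def)
qed

text \<open>If all rows of \<open>M ^\<^sub>m k\<close> equal one row r, then
  \<open>\<mu> * M ^\<^sub>m k\<close> is a convex combination of copies of r, hence r itself. A
  stationary row is fixed by \<open>M ^\<^sub>m k\<close>, so it can only be r.\<close>

lemma equal_rows_pow_imp_stationary:
  assumes M: "stochastic_mat n M" and "0 < n"
    and rows: "\<And>i i' j. i < n \<Longrightarrow> i' < n \<Longrightarrow> j < n \<Longrightarrow> (M ^\<^sub>m k) $$ (i, j) = (M ^\<^sub>m k) $$ (i', j)"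
  shows "\<exists>!\<pi>. stationary M \<pi>"
    and "stationary M \<pi> \<Longrightarrow> prob_row n \<mu> \<Longrightarrow> \<mu> * M ^\<^sub>m k = \<pi>"
proof -
  have c: "M \<in> carrier_mat n n" "M ^\<^sub>m k \<in> carrier_mat n n"
    using M by (auto simp: stochastic_mat_def)
  have eq: "\<mu> * M ^\<^sub>m k = \<nu> * M ^\<^sub>m k" if "prob_row n \<mu>" "prob_row n \<nu>" for \<mu> \<nu>
  proof (rule eq_matI)
    have entry: "(\<rho> * M ^\<^sub>m k) $$ (0, j) = (M ^\<^sub>m k) $$ (0, j)" if "prob_row n \<rho>" "j < n" for \<rho> j
    proof -
      have "(\<rho> * M ^\<^sub>m k) $$ (0, j) = (\<Sum>i<n. \<rho> $$ (0, i) * (M ^\<^sub>m k) $$ (i, j))"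
        using that c by (intro index_mult_mat_sum[of _ 1]) (auto simp: prob_row_def)
      also have "\<dots> = (\<Sum>i<n. \<rho> $$ (0, i) * (M ^\<^sub>m k) $$ (0, j))"
        using that \<open>0 < n\<close> by (intro sum.cong refl arg_cong2[where f = "(*)"] rows) auto
      also have "\<dots> = (M ^\<^sub>m k) $$ (0, j)"
        using that by (simp add: prob_row_def flip: sum_distrib_right)
      finally show ?thesis .
    qed
    fix i j assume "i < dim_row (\<nu> * M ^\<^sub>m k)" "j < dim_col (\<nu> * M ^\<^sub>m k)"
    then have "i = 0" "j < n" using that c by (auto simp: prob_row_def simp del: pow_mat_dim)
    then show "(\<mu> * M ^\<^sub>m k) $$ (i, j) = (\<nu> * M ^\<^sub>m k) $$ (i, j)"
      by (simp add: entry[OF that(1)] entry[OF that(2)])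
  qed (use that in \<open>auto simp: prob_row_def\<close>)
  show 2: "\<mu> * M ^\<^sub>m k = \<pi>" if "stationary M \<pi>" "prob_row n \<mu>" for \<mu> \<pi>
    using eq[OF that(2), of \<pi>] stationary_mult_pow[OF c(1) that(1)] that(1) c
    by (simp add: stationary_def)
  \<comment> \<open>The point mass at state 0, a probability row because \<open>0 < n\<close>; it
    serves to name the common row.\<close>
  define e where "e = (mat 1 n (\<lambda>(i, j). if j = 0 then 1 else 0) :: real mat)"
  have e: "prob_row n e"
    using \<open>0 < n\<close> by (auto simp: prob_row_def e_def)
  \<comment> \<open>Invariance: the extra factor \<open>M\<close> is moved to the front, where it
    only turns \<open>e\<close> into another probability row, and \<open>eq\<close> ignores that
    change.\<close>
  have "e * M ^\<^sub>m k * M = e * M ^\<^sub>m Suc k"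
    using e c by (auto simp: prob_row_def intro!: assoc_mult_mat[of _ 1 n _ n _ n])
  also have "\<dots> = e * M * M ^\<^sub>m k"
    unfolding pow_mat_Suc_left[OF c(1)]
    using e c by (auto simp: prob_row_def intro!: assoc_mult_mat[symmetric, of _ 1 n _ n _ n])
  also have "\<dots> = e * M ^\<^sub>m k"
    by (intro eq prob_row_mult[OF M] e)
  finally have "stationary M (e * M ^\<^sub>m k)"
    using prob_row_mult_pow[OF M e] c by (simp add: stationary_def)
  then show "\<exists>!\<pi>. stationary M \<pi>"
    using 2[OF _ e] by blast
qed

section \<open>The driven chain\<close>

text \<open>A recursive, zero-based form of \<open>erase_one\<close> that leaves the word alone when
  the index is too large. This totality lets one map cover transitions (2) and (3).\<close>

fun clear_one :: "nat \<Rightarrow> bool list \<Rightarrow> bool list" where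
  "clear_one i [] = []"
| "clear_one i (False # w) = False # clear_one i w"
| "clear_one 0 (True # w) = False # w"
| "clear_one (Suc i) (True # w) = True # clear_one i w"

lemma num_ones_simps [simp]:
  "num_ones [] = 0" "num_ones (True # w) = Suc (num_ones w)" "num_ones (False # w) = num_ones w"
  by (simp_all add: num_ones_def)

lemma length_clear_one [simp]: "length (clear_one i w) = length w"
  by (induction i w rule: clear_one.induct) auto

text \<open>Locality: whether a letter is cleared is decided by the ones up to it, never by letters
  further right.\<close>

lemma take_clear_one: "take k (clear_one i w) = clear_one i (take k w)"
proof (induction i w arbitrary: k rule: clear_one.induct)
  case (2 i w) then show ?case by (cases k) auto
next
  case (3 w) then show ?case by (cases k) auto
next
  case (4 i w) then show ?case by (cases k) auto
qed simp

lemma clear_one_eq_self: "num_ones w \<le> i \<Longrightarrow> clear_one i w = w"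
  by (induction i w rule: clear_one.induct) auto

lemma num_ones_clear_one: "i < num_ones w \<Longrightarrow> Suc (num_ones (clear_one i w)) = num_ones w"
  by (induction i w rule: clear_one.induct) auto

lemma one_positions_Cons:
  "one_positions (c # w) = (if c then [0] else []) @ map Suc (one_positions w)"
proof -
  have "[0..<length (c # w)] = 0 # map Suc [0..<length w]"
    by (simp add: upt_conv_Cons map_Suc_upt del: upt_Suc)
  then show ?thesis by (simp add: one_positions_def filter_map comp_def)
qed

lemma length_one_positions: "length (one_positions w) = num_ones w"
proof (induction w)
  case Nil then show ?case by (simp add: one_positions_def)
next
  case (Cons c w) then show ?case by (cases c) (auto simp: one_positions_Cons)
qed

lemma update_one_position_eq_clear_one:
  "i < num_ones w \<Longrightarrow> w[one_positions w ! i := False] = clear_one i w"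
  by (induction i w rule: clear_one.induct)
    (auto simp: one_positions_Cons length_one_positions)

lemma erase_one_Suc: "i < num_ones w \<Longrightarrow> erase_one (Suc i) w = clear_one i w"
  by (simp add: erase_one_def update_one_position_eq_clear_one)

text \<open>The driven move: the index has law \<open>x\<close> whatever the current word is.
  Indices above the number of remaining ones clear nothing and together make up transition
  (3).\<close>

fun rjmc_step :: "nat \<Rightarrow> bool list \<Rightarrow> bool list" where
  "rjmc_step 0 w = False # butlast w"
| "rjmc_step (Suc i) w = True # clear_one i (butlast w)"

lemma num_ones_butlast_le: "num_ones (butlast w) \<le> num_ones w"
  by (induction w) (auto simp: num_ones_def)

lemma rjmc_step_in_binary_words:
  assumes "w \<in> binary_words m b" "1 \<le> m" "i \<le> b"
  shows "rjmc_step i w \<in> binary_words m b"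
proof -
  have l: "num_ones (butlast w) \<le> b" "length w = m"
    using assms num_ones_butlast_le[of w] by (auto simp: binary_words_def)
  show ?thesis
  proof (cases i)
    case 0
    then show ?thesis using l assms by (simp add: binary_words_def)
  next
    case (Suc j)
    \<comment> \<open>Either a one is cleared and makes up for the one pushed in front, or
      \<open>butlast w\<close> has at most \<open>j\<close> ones, and \<open>j < b\<close> leaves
      room for another.\<close>
    have "Suc (num_ones (clear_one j (butlast w))) \<le> b"
      using l Suc assms num_ones_clear_one[of j "butlast w"] clear_one_eq_self[of "butlast w" j]
      by (cases "j < num_ones (butlast w)") auto
    then show ?thesis using l Suc assms by (simp add: binary_words_def)
  qed
qed

text \<open>The pushed letter depends on \<open>i\<close> alone and clearing is local, so a common
  prefix grows by one letter. As \<open>k\<close> is below the length, the dropped last letter lies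
  outside the prefix.\<close>

lemma take_rjmc_step_cong:
  assumes "take k w = take k w'" "length w = length w'" "k < length w"
  shows "take (Suc k) (rjmc_step i w) = take (Suc k) (rjmc_step i w')"
proof -
  have "take k (butlast w) = take k (butlast w')"
    using assms by (simp add: take_butlast)
  then show ?thesis by (cases i) (simp_all add: take_clear_one)
qed

lemma rjmc_prob_eq_sum_step:
  assumes "num_ones w \<le> b"
  shows "rjmc_prob b x w v = (\<Sum>i\<le>b. if v = rjmc_step i w then x i else 0)"
proof -
  define u where "u = butlast w"
  define l where "l = num_ones u"
  have "l \<le> b" using assms num_ones_butlast_le[of w] by (simp add: l_def u_def)
  let ?f = "\<lambda>i. if v = rjmc_step i w then x i else 0"
  \<comment> \<open>The three blocks of indices correspond to the three kinds of transition.\<close>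
  have "{..b} = {0} \<union> {1..l} \<union> {l+1..b}" using \<open>l \<le> b\<close> by auto
  then have "(\<Sum>i\<le>b. ?f i) = ?f 0 + (\<Sum>i=1..l. ?f i) + (\<Sum>i=l+1..b. ?f i)"
    by (simp add: sum.union_disjoint)
  moreover have "(\<Sum>i=1..l. ?f i) = (\<Sum>i=1..l. if v = True # erase_one i u then x i else 0)"
  proof (rule sum.cong[OF refl])
    fix i assume "i \<in> {1..l}"
    then obtain j where "i = Suc j" "j < l" by (cases i) auto
    then show "?f i = (if v = True # erase_one i u then x i else 0)"
      by (simp add: erase_one_Suc l_def u_def)
  qed
  moreover have "(\<Sum>i=l+1..b. ?f i) = (\<Sum>i=l+1..b. if v = True # u then x i else 0)"
  proof (rule sum.cong[OF refl])
    fix i assume "i \<in> {l+1..b}"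
    then obtain j where "i = Suc j" "l \<le> j" by (cases i) auto
    then show "?f i = (if v = True # u then x i else 0)"
      by (simp add: clear_one_eq_self l_def u_def)
  qed
  ultimately show ?thesis
    by (simp add: rjmc_prob_def Let_def flip: u_def l_def)
qed

section \<open>The transition matrix\<close>

context
  fixes m b :: nat and x :: "nat \<Rightarrow> real" and ws :: "bool list list"
  assumes m_pos: "1 \<le> m"
    and ws: "distinct ws" "set ws = binary_words m b"
begin

lemma nth_ws: "j < length ws \<Longrightarrow> ws ! j \<in> binary_words m b"
  using ws nth_mem by blast

text \<open>The transition operator applied to a function \<open>g\<close> of words is the average
  of \<open>g\<close> over the driven moves.\<close>

lemma sum_rjmc_matrix:
  assumes "j < length ws"
  shows "(\<Sum>k<length ws. rjmc_matrix b x ws $$ (j, k) * g (ws ! k)) =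
    (\<Sum>i\<le>b. x i * g (rjmc_step i (ws ! j)))"
proof -
  let ?w = "ws ! j"
  have "(\<Sum>k<length ws. rjmc_matrix b x ws $$ (j, k) * g (ws ! k)) =
      (\<Sum>k<length ws. rjmc_prob b x ?w (ws ! k) * g (ws ! k))"
    using assms by (simp add: rjmc_matrix_def)
  also have "\<dots> = (\<Sum>v\<in>set ws. rjmc_prob b x ?w v * g v)"
    by (rule sum.reindex_bij_betw[OF bij_betw_nth]) (use ws in auto)
  also have "\<dots> = (\<Sum>v\<in>set ws. \<Sum>i\<le>b. if v = rjmc_step i ?w then x i * g v else 0)"
    using nth_ws[OF assms] by (auto simp: rjmc_prob_eq_sum_step binary_words_def
        sum_distrib_right intro!: sum.cong)
  also have "\<dots> = (\<Sum>i\<le>b. \<Sum>v\<in>set ws. if v = rjmc_step i ?w then x i * g v else 0)"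
    by (rule sum.swap)
  \<comment> \<open>Each inner sum collapses to its single nonzero candidate, since the state space
    is closed under the moves.\<close>
  also have "\<dots> = (\<Sum>i\<le>b. x i * g (rjmc_step i ?w))"
    using rjmc_step_in_binary_words[OF nth_ws[OF assms] m_pos]
    by (intro sum.cong) (auto simp flip: ws(2))
  finally show ?thesis .
qed

lemma stochastic_rjmc_matrix:
  assumes "\<forall>i\<le>b. 0 \<le> x i" "(\<Sum>i\<le>b. x i) = 1"
  shows "stochastic_mat (length ws) (rjmc_matrix b x ws)"
  unfolding stochastic_mat_def
proof (intro conjI allI impI)
  show "rjmc_matrix b x ws \<in> carrier_mat (length ws) (length ws)"
    by (simp add: rjmc_matrix_def)
  fix j assume j: "j < length ws"
  show "(\<Sum>k<length ws. rjmc_matrix b x ws $$ (j, k)) = 1"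
    using sum_rjmc_matrix[OF j, of "\<lambda>_. 1"] assms by simp
  fix k assume "k < length ws"
  then show "0 \<le> rjmc_matrix b x ws $$ (j, k)"
    using j nth_ws[OF j] assms
    by (auto simp: rjmc_matrix_def rjmc_prob_eq_sum_step binary_words_def intro!: sum_nonneg)
qed

text \<open>Induction on \<open>n\<close> by coupling: both words are moved with the same random
  index, which lengthens their common prefix by one. The rows \<open>j\<close> and \<open>j'\<close>
  vary because the hypothesis is applied to the successor states.\<close>

lemma rjmc_matrix_pow_cong:
  assumes "n \<le> m" "j < length ws" "j' < length ws" "l < length ws"
    and "take (m - n) (ws ! j) = take (m - n) (ws ! j')"
  shows "(rjmc_matrix b x ws ^\<^sub>m n) $$ (j, l) = (rjmc_matrix b x ws ^\<^sub>m n) $$ (j', l)"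
  using assms
proof (induction n arbitrary: j j')
  case 0
  \<comment> \<open>With \<open>n = 0\<close> the prefix is the whole word.\<close>
  then have "ws ! j = ws ! j'"
    using nth_ws by (simp add: binary_words_def)
  then show ?case
    using 0 ws(1) by (simp add: nth_eq_iff_index_eq)
next
  case (Suc n)
  let ?M = "rjmc_matrix b x ws" and ?N = "length ws"
  have c: "?M \<in> carrier_mat ?N ?N" by (simp add: rjmc_matrix_def)
  \<comment> \<open>The inverse of the enumeration turns a column of the matrix power into a
    function of words, as \<open>sum_rjmc_matrix\<close> requires.\<close>
  define idx where "idx v = (SOME k. k < ?N \<and> ws ! k = v)" for v
  have idx: "idx v < ?N" "ws ! idx v = v" if "v \<in> binary_words m b" for v
  proof -
    have "\<exists>k. k < ?N \<and> ws ! k = v"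
      using that by (simp add: in_set_conv_nth flip: ws(2))
    from someI_ex[OF this] show "idx v < ?N" "ws ! idx v = v"
      by (simp_all add: idx_def)
  qed
  have idx_nth: "idx (ws ! k) = k" if "k < ?N" for k
    using idx[OF nth_ws[OF that]] that ws(1) by (simp add: nth_eq_iff_index_eq)
  have entry: "(?M ^\<^sub>m Suc n) $$ (i, l) =
      (\<Sum>a\<le>b. x a * (?M ^\<^sub>m n) $$ (idx (rjmc_step a (ws ! i)), l))" if "i < ?N" for i
  proof -
    have "(?M ^\<^sub>m Suc n) $$ (i, l) = (\<Sum>k<?N. ?M $$ (i, k) * (?M ^\<^sub>m n) $$ (k, l))"
      unfolding pow_mat_Suc_left[OF c]
      using c that Suc.prems by (intro index_mult_mat_sum[of _ ?N]) auto
    also have "\<dots> = (\<Sum>k<?N. ?M $$ (i, k) * (?M ^\<^sub>m n) $$ (idx (ws ! k), l))"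
      by (simp add: idx_nth)
    finally show ?thesis
      using sum_rjmc_matrix[OF that, of "\<lambda>v. (?M ^\<^sub>m n) $$ (idx v, l)"] by simp
  qed
  have "(?M ^\<^sub>m n) $$ (idx (rjmc_step a (ws ! j)), l) =
      (?M ^\<^sub>m n) $$ (idx (rjmc_step a (ws ! j')), l)" if "a \<le> b" for a
  proof (rule Suc.IH)
    have s: "rjmc_step a (ws ! i) \<in> binary_words m b" if "i < ?N" for i
      using rjmc_step_in_binary_words[OF nth_ws m_pos \<open>a \<le> b\<close>] that .
    show "idx (rjmc_step a (ws ! j)) < ?N" "idx (rjmc_step a (ws ! j')) < ?N"
      using s idx Suc.prems by auto
    have "length (ws ! j) = m" "length (ws ! j') = m"
      using nth_ws Suc.prems by (auto simp: binary_words_def)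
    then have "take (Suc (m - Suc n)) (rjmc_step a (ws ! j)) =
        take (Suc (m - Suc n)) (rjmc_step a (ws ! j'))"
      using Suc.prems by (intro take_rjmc_step_cong) auto
    \<comment> \<open>Here \<open>Suc n \<le> m\<close> keeps the subtraction from being
      truncated.\<close>
    moreover have "Suc (m - Suc n) = m - n" using Suc.prems by simp
    ultimately show "take (m - n) (ws ! idx (rjmc_step a (ws ! j))) =
        take (m - n) (ws ! idx (rjmc_step a (ws ! j')))"
      using s idx Suc.prems by simp
  qed (use Suc.prems in auto)
  then show ?case
    using Suc.prems by (simp add: entry del: pow_mat.simps)
qed

end

theorem theorem2p6:
  fixes m b :: nat and x :: "nat \<Rightarrow> real" and ws :: "bool list list"
  assumes "1 \<le> b" and "b \<le> m"
    and "\<forall>i\<le>b. 0 \<le> x i" and "(\<Sum>i\<le>b. x i) = 1"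
    and "distinct ws" and "set ws = binary_words m b"
  shows "(\<exists>!\<pi>. stationary (rjmc_matrix b x ws) \<pi>) \<and>
    (\<forall>\<pi> \<mu>. stationary (rjmc_matrix b x ws) \<pi> \<longrightarrow> prob_row (length ws) \<mu> \<longrightarrow>
      \<mu> * (rjmc_matrix b x ws) ^\<^sub>m m = \<pi>)"
proof -
  have m: "1 \<le> m" using assms by simp
  \<comment> \<open>The all-zero word shows that there is at least one state.\<close>
  have "replicate m False \<in> set ws"
    using assms(6) by (simp add: binary_words_def num_ones_def count_list_0_iff)
  then have "0 < length ws" by (cases ws) auto
  note main = equal_rows_pow_imp_stationary[OF
      stochastic_rjmc_matrix[OF m assms(5,6,3,4)] this, where k = m]
  \<comment> \<open>After \<open>m\<close> steps the required common prefix has length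
    \<open>m - m = 0\<close>, so any two rows agree.\<close>
  have "(rjmc_matrix b x ws ^\<^sub>m m) $$ (i, j) = (rjmc_matrix b x ws ^\<^sub>m m) $$ (i', j)"
    if "i < length ws" "i' < length ws" "j < length ws" for i i' j
    using rjmc_matrix_pow_cong[OF m assms(5,6), of m i i' j] that by simp
  then show ?thesis using main by blast
qed

end
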